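(* Let $(X,\mathrm{d})$ be a metric space with induced topology $\tau_{\mathrm{d}}$, let $(X,\tau_{\mathrm{d}},\to)$ be a topological rewriting system, and let $\rightsquigarrow$ be a subrelation of its topological rewriting relation $\xrightarrow{\mathrm{top}}$. Assume: 1. the relation $\xrightarrow{\mathrm{top}}$ is transitive; 2. the system is normalising with respect to $\rightsquigarrow$; 3. the system has globally attractive normal forms. Then, if the system is finitary topologically confluent, it has the unique normal form property with respect to $\rightsquigarrow$.
   Context: A topological rewriting system $(X,\tau,\to)$ is a topological space $(X,\tau)$ with a binary relation $\to$ on $X$. $\xrightarrow{\star}$ is the transitive reflexive closure of $\to$. The topological rewriting relation $\xrightarrow{\mathrm{top}}$ is the closure of $\xrightarrow{\star}$, viewed as a subset of $X\times X$ with the product of the discrete topology on the first factor and $\tau$ on the second. A normal form is an $a\in X$ for which there is no $b\in X$ with $a\to b$. For a subrelation $\rightsquigarrow$ of $\xrightarrow{\mathrm{top}}$, let $\rightsquigarrow^{\star}$ be its transitive reflexive closure. The system is normalising with respect to $\rightsquigarrow$ if for all $a\in X$ there is a normal form $b$ with $a\rightsquigarrow^{\star}b$. It has the unique normal form property with respect to $\rightsquigarrow$ if any two normal forms $a,b$ that are related by the equivalence relation generated by $\rightsquigarrow$ satisfy $a=b$. When $\tau=\tau_{\mathrm{d}}$ is induced by a metric $\mathrm{d}$, the system has globally attractive normal forms if, for any normal form $c$ and any $a,b\in X$ with $a\xrightarrow{\mathrm{top}}b$, we have $\mathrm{d}(b,c)\le\mathrm{d}(a,c)$. The system is finitary topologically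 confluent if for all $a,b,c\in X$ with $a\xrightarrow{\star}b$ and $a\xrightarrow{\star}c$ there is $d\in X$ with $b\xrightarrow{\mathrm{top}}d$ and $c\xrightarrow{\mathrm{top}}d$. *)

theory Defs
  imports "HOL-Analysis.Analysis"
begin

text \<open>
  The underlying set of a system is the carrier \<open>topspace T\<close> of an abstract topology, not a whole
  type. The library closures \<open>r\<^sup>*\<close> and \<^const>\<open>equivclp\<close> live on the whole type; for a relation on
  the carrier they differ from the closures taken inside the carrier only by diagonal pairs outside
  it. These are discarded by \<^const>\<open>closure_of\<close>, or excluded by the quantifiers, below.
\<close>

definition topological_rewriting_system :: "'a topology \<Rightarrow> ('a \<times> 'a) set \<Rightarrow> bool" where
  "topological_rewriting_system T r \<longleftrightarrow> r \<subseteq> topspace T \<times> topspace T"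

definition topological_rewriting :: "'a topology \<Rightarrow> ('a \<times> 'a) set \<Rightarrow> ('a \<times> 'a) set" where
  "topological_rewriting T r =
     prod_topology (discrete_topology (topspace T)) T closure_of (r\<^sup>*)"

definition normal_form :: "'a topology \<Rightarrow> ('a \<times> 'a) set \<Rightarrow> 'a \<Rightarrow> bool" where
  "normal_form T r a \<longleftrightarrow> a \<in> topspace T \<and> \<not> (\<exists>b\<in>topspace T. (a, b) \<in> r)"

definition normalising_wrt :: "'a topology \<Rightarrow> ('a \<times> 'a) set \<Rightarrow> ('a \<times> 'a) set \<Rightarrow> bool" where
  "normalising_wrt T r s \<longleftrightarrow> (\<forall>a\<in>topspace T. \<exists>b. normal_form T r b \<and> (a, b) \<in> s\<^sup>*)"

definition unique_normal_form_property_wrt ::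
    "'a topology \<Rightarrow> ('a \<times> 'a) set \<Rightarrow> ('a \<times> 'a) set \<Rightarrow> bool" where
  "unique_normal_form_property_wrt T r s \<longleftrightarrow>
     (\<forall>a b. normal_form T r a \<and> normal_form T r b \<and> equivclp (\<lambda>x y. (x, y) \<in> s) a b \<longrightarrow> a = b)"

definition finitary_topologically_confluent :: "'a topology \<Rightarrow> ('a \<times> 'a) set \<Rightarrow> bool" where
  "finitary_topologically_confluent T r \<longleftrightarrow>
     (\<forall>a\<in>topspace T. \<forall>b\<in>topspace T. \<forall>c\<in>topspace T. (a, b) \<in> r\<^sup>* \<and> (a, c) \<in> r\<^sup>* \<longrightarrow>
        (\<exists>d\<in>topspace T. (b, d) \<in> topological_rewriting T r \<and> (c, d) \<in> topological_rewriting T r))"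

definition (in Metric_space) globally_attractive_normal_forms :: "('a \<times> 'a) set \<Rightarrow> bool" where
  "globally_attractive_normal_forms r \<longleftrightarrow>
     (\<forall>c. normal_form mtopology r c \<longrightarrow>
        (\<forall>a\<in>M. \<forall>b\<in>M. (a, b) \<in> topological_rewriting mtopology r \<longrightarrow> d b c \<le> d a c))"

end

theory Submission
  imports Defs
begin

text \<open>
  The heart of the proof is that a point has at most one normal form as a limit of its reducts.
  Suppose that \<open>c\<close> and \<open>c'\<close> are normal forms, both related to \<open>a\<close> by topological rewriting. Then
  \<open>a\<close> has reducts \<open>b\<close> and \<open>b'\<close>, each reached in finitely many steps, that lie within \<open>\<epsilon>\<close> of \<open>c\<close>
  and \<open>c'\<close>. Finitary confluence applies to \<open>b\<close> and \<open>b'\<close> and joins them in a point \<open>e\<close>, and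
  attraction prevents the passage to \<open>e\<close> from increasing either distance. So \<open>e\<close> is within
  \<open>\<epsilon>\<close> of both normal forms, whence \<open>d c c' < 2 * \<epsilon>\<close>. This is
  \<open>limit_normal_form_unique\<close>.

  Consequently a step \<open>(x, y) \<in> s\<close> does not change the set of normal forms that are reachable
  topologically: those of \<open>y\<close> are reachable from \<open>x\<close> by transitivity, and since \<open>y\<close> has one and
  \<open>x\<close> has at most one, the sets agree (\<open>step_preserves_limit_normal_form\<close>). This set is therefore
  constant on the classes of the equivalence generated by \<open>s\<close>. A normal form belongs to its own
  set, so equivalent normal forms are equal.
\<close>

lemma topological_rewriting_subset_carrier:
  "topological_rewriting T r \<subseteq> topspace T \<times> topspace T"
  unfolding topological_rewriting_def
  using closure_of_subset_topspace[of "prod_topology (discrete_topology (topspace T)) T"] by simp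

lemma topological_rewriting_refl:
  assumes "a \<in> topspace T"
  shows "(a, a) \<in> topological_rewriting T r"
  using assms unfolding topological_rewriting_def in_closure_of by auto

lemma rtrancl_subrelation_topological_rewriting:
  assumes "s \<subseteq> topological_rewriting T r" "trans (topological_rewriting T r)"
    and "a \<in> topspace T" "(a, b) \<in> s\<^sup>*"
  shows "(a, b) \<in> topological_rewriting T r"
  using assms(4)
proof (induction rule: rtrancl_induct)
  case base
  show ?case using assms(3) by (rule topological_rewriting_refl)
next
  case (step y z)
  show ?case
    using transD[OF assms(2) step.IH subsetD[OF assms(1) step.hyps(2)]] .
qed

text \<open>
  Since the first factor is discrete, \<open>{a} \<times> mball b \<epsilon>\<close> is a neighbourhood of \<open>(a, b)\<close>; so the
  approximating pairs can be taken to start at \<open>a\<close> itself.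
\<close>

lemma (in Metric_space) topological_rewriting_approx:
  assumes "(a, b) \<in> topological_rewriting mtopology r" "\<epsilon> > 0"
  obtains c where "c \<in> M" "(a, c) \<in> r\<^sup>*" "d c b < \<epsilon>"
proof -
  have M: "a \<in> M" "b \<in> M"
    using assms(1) topological_rewriting_subset_carrier[of mtopology r] by auto
  have "openin (prod_topology (discrete_topology M) mtopology) ({a} \<times> mball b \<epsilon>)"
    using M by (simp add: openin_prod_Times_iff)
  moreover have "(a, b) \<in> {a} \<times> mball b \<epsilon>"
    using M assms(2) by simp
  moreover have "\<forall>U. (a, b) \<in> U \<and> openin (prod_topology (discrete_topology M) mtopology) U \<longrightarrow>
      (\<exists>p. p \<in> r\<^sup>* \<and> p \<in> U)"
    using assms(1) unfolding topological_rewriting_def in_closure_of topspace_mtopology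
    by (rule conjunct2)
  ultimately obtain p where p: "p \<in> r\<^sup>*" "p \<in> {a} \<times> mball b \<epsilon>"
    by meson
  obtain c where "p = (a, c)" "c \<in> mball b \<epsilon>"
    using p(2) by (rule SigmaE) simp
  with p(1) show thesis
    by (intro that[of c]) (simp_all add: commute)
qed

text \<open>
  Confluence is available only below finite reductions, whereas \<open>c\<close> and \<open>c'\<close> are mere limits of
  reducts of \<open>a\<close>; hence the detour through approximations, whose error attraction keeps bounded.
\<close>

lemma (in Metric_space) limit_normal_form_unique:
  assumes attractive: "globally_attractive_normal_forms r"
    and confluent: "finitary_topologically_confluent mtopology r"
    and ac: "(a, c) \<in> topological_rewriting mtopology r" and c: "normal_form mtopology r c"
    and ac': "(a, c') \<in> topological_rewriting mtopology r" and c': "normal_form mtopology r c'"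
  shows "c = c'"
proof -
  have M: "a \<in> M" "c \<in> M" "c' \<in> M"
    using ac ac' topological_rewriting_subset_carrier[of mtopology r] by auto
  have "d c c' \<le> 0"
  proof (rule field_le_epsilon)
    fix \<epsilon> :: real assume "\<epsilon> > 0"
    then have half: "\<epsilon> / 2 > 0" by simp
    obtain b where b: "b \<in> M" "(a, b) \<in> r\<^sup>*" "d b c < \<epsilon> / 2"
      using topological_rewriting_approx[OF ac half] .
    obtain b' where b': "b' \<in> M" "(a, b') \<in> r\<^sup>*" "d b' c' < \<epsilon> / 2"
      using topological_rewriting_approx[OF ac' half] .
    obtain e where e: "e \<in> M" "(b, e) \<in> topological_rewriting mtopology r"
        "(b', e) \<in> topological_rewriting mtopology r"
      using confluent M(1) b b' unfolding finitary_topologically_confluent_def by fastforce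
    have "d e c \<le> d b c" "d e c' \<le> d b' c'"
      using attractive c c' b(1) b'(1) e unfolding globally_attractive_normal_forms_def by blast+
    then show "d c c' \<le> 0 + \<epsilon>"
      using triangle[OF M(2) e(1) M(3)] commute[of c e] b(3) b'(3) by linarith
  qed
  then show ?thesis
    using M nonneg[of c c'] zero[of c c'] by linarith
qed

text \<open>
  From right to left this is transitivity. In the other direction, \<open>y\<close> has some normal form
  because the system is normalising; that one is also reachable from \<open>x\<close>, so uniqueness at \<open>x\<close>
  identifies it with \<open>c\<close>.
\<close>

lemma step_preserves_limit_normal_form:
  assumes sub: "s \<subseteq> topological_rewriting T r" and trans: "trans (topological_rewriting T r)"
    and normalising: "normalising_wrt T r s"
    and unique: "\<And>a c c'. (a, c) \<in> topological_rewriting T r \<Longrightarrow> normal_form T r c \<Longrightarrow>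
      (a, c') \<in> topological_rewriting T r \<Longrightarrow> normal_form T r c' \<Longrightarrow> c = c'"
    and xy: "(x, y) \<in> s" and c: "normal_form T r c"
  shows "(x, c) \<in> topological_rewriting T r \<longleftrightarrow> (y, c) \<in> topological_rewriting T r"
proof
  have x_y: "(x, y) \<in> topological_rewriting T r"
    using sub xy by blast
  show "(x, c) \<in> topological_rewriting T r" if "(y, c) \<in> topological_rewriting T r"
    using transD[OF trans x_y that] .
  have y: "y \<in> topspace T"
    using subsetD[OF topological_rewriting_subset_carrier x_y] by simp
  then obtain c' where c': "normal_form T r c'" "(y, c') \<in> s\<^sup>*"
    using normalising unfolding normalising_wrt_def by blast
  have y_c': "(y, c') \<in> topological_rewriting T r"
    using rtrancl_subrelation_topological_rewriting[OF sub trans y c'(2)] .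
  have "(x, c') \<in> topological_rewriting T r"
    using transD[OF trans x_y y_c'] .
  then show "(y, c) \<in> topological_rewriting T r" if "(x, c) \<in> topological_rewriting T r"
    using unique[OF that c _ c'(1)] y_c' by simp
qed

theorem theorem11:
  fixes X :: "'a set" and d :: "'a \<Rightarrow> 'a \<Rightarrow> real"
    and \<tau>\<^sub>d :: "'a topology" and r s :: "('a \<times> 'a) set"
  assumes "Metric_space X d"
    and "\<tau>\<^sub>d = Metric_space.mtopology X d"
    and "topological_rewriting_system \<tau>\<^sub>d r"
    and "s \<subseteq> topological_rewriting \<tau>\<^sub>d r"
    and "trans (topological_rewriting \<tau>\<^sub>d r)"
    and "normalising_wrt \<tau>\<^sub>d r s"
    and "Metric_space.globally_attractive_normal_forms X d r"
    and "finitary_topologically_confluent \<tau>\<^sub>d r"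
  shows "unique_normal_form_property_wrt \<tau>\<^sub>d r s"
proof -
  interpret Metric_space X d by (rule assms(1))
  note unique = limit_normal_form_unique[OF assms(7) assms(8)[unfolded assms(2)],
      folded assms(2)]
  have invariant: "(x, c) \<in> topological_rewriting \<tau>\<^sub>d r \<longleftrightarrow> (y, c) \<in> topological_rewriting \<tau>\<^sub>d r"
    if "(x, y) \<in> s" "normal_form \<tau>\<^sub>d r c" for x y c
    by (rule step_preserves_limit_normal_form[OF assms(4-6) _ that]) (rule unique)
  show ?thesis
    unfolding unique_normal_form_property_wrt_def
  proof (intro allI impI, elim conjE)
    fix a b
    assume a: "normal_form \<tau>\<^sub>d r a" and b: "normal_form \<tau>\<^sub>d r b"
      and equiv: "equivclp (\<lambda>x y. (x, y) \<in> s) a b"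
    have refl: "(a, a) \<in> topological_rewriting \<tau>\<^sub>d r" "(b, b) \<in> topological_rewriting \<tau>\<^sub>d r"
      using a b by (simp_all add: normal_form_def topological_rewriting_refl)
    from equiv
    have "(a, b) \<in> topological_rewriting \<tau>\<^sub>d r \<longleftrightarrow> (b, b) \<in> topological_rewriting \<tau>\<^sub>d r"
    proof (induction rule: equivclp_induct[where
          P = "\<lambda>y. (a, b) \<in> topological_rewriting \<tau>\<^sub>d r \<longleftrightarrow> (y, b) \<in> topological_rewriting \<tau>\<^sub>d r",
          consumes 1, case_names base step])
      case base
      show ?case ..
    next
      case (step y z)
      then show ?case
        using invariant[OF _ b] by blast
    qed
    then show "a = b"
      using unique[OF refl(1) a _ b] refl(2) by blast
  qed
qed

end
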